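(* Let $B$ and $R$ be two graphs with the same vertex set $V$. Assume that the following hold: (i) $B$ and $R$ are $C_4$-free graphs; (ii) $G(B,R)$ does not contain a double $C_5$; (iii) $G(B,R)$ is the complete graph on $V$; (iv) every proper subset $U\subset V$ is obedient. If there are distinct vertices $v_1,\dots,v_5\in V$ such that $v_1-v_2-v_3-v_4-v_5-v_1$ is an induced $C_5$ in $R$ and $v_1v_2, v_3v_4\in E(R\setminus B)$, then $V$ is obedient.
   Context: All graphs are simple (no loops or multiple edges). For two graphs $B,R$ on the same vertex set $V$, $G(B,R)$ is the graph with vertex set $V$ in which two vertices are adjacent if they are adjacent in at least one of $B$ and $R$; $R\setminus B$ is the graph with vertex set $V$ in which two vertices are adjacent if and only if they are adjacent in $R$ and non-adjacent in $B$; $E(\cdot)$ denotes the edge set. A clique in a graph is a set of pairwise adjacent vertices (the empty set is allowed). A subset $U\subseteq V$ is obedient if there exist a clique $X$ of $R$ and a clique $Y$ of $B$ such that $U=X\cup Y$. For $S\subseteq V$, $G|S$ denotes the subgraph of $G$ induced by $S$. A graph is $H$-free if none of its induced subgraphs is isomorphic to $H$; $C_k$ is the cycle on $k$ vertices. $G(B,R)$ contains a double $C_5$ if there is a set $S\subseteq V$ of five vertices such that $B|S$ and $R|S$ are both isomorphic to $C_5$. Saying that $v_1-v_2-v_3-v_4-v_5-v_1$ is an induced $C_5$ in $R$ means that the edges of $R|\{v_1,\dots,v_5\}$ are exactly $v_1v_2,v_2v_3,v_3v_4,v_4v_5,v_5v_1$. *)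

theory Defs
  imports Main
begin

record 'a graph =
  verts :: "'a set"
  edges :: "'a set set"

text \<open>Edges are unordered pairs of distinct vertices. Vertex sets are not required to be finite.\<close>

definition simple_graph :: "'a graph \<Rightarrow> bool" where
  "simple_graph G \<longleftrightarrow> edges G \<subseteq> {{x, y} | x y. x \<in> verts G \<and> y \<in> verts G \<and> x \<noteq> y}"

definition adjacent :: "'a graph \<Rightarrow> 'a \<Rightarrow> 'a \<Rightarrow> bool" where
  "adjacent G x y \<longleftrightarrow> {x, y} \<in> edges G"

definition complete_graph :: "'a set \<Rightarrow> 'a graph" where
  "complete_graph V = \<lparr>verts = V, edges = {{x, y} | x y. x \<in> V \<and> y \<in> V \<and> x \<noteq> y}\<rparr>"

text \<open>Meaningful for \<open>k \<ge> 3\<close> only.\<close>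

definition cycle_graph :: "nat \<Rightarrow> nat graph" where
  "cycle_graph k = \<lparr>verts = {..<k}, edges = {{i, Suc i mod k} | i. i < k}\<rparr>"

text \<open>The next two operations are meant for graphs with \<open>verts B = verts R\<close>.\<close>

definition graph_union :: "'a graph \<Rightarrow> 'a graph \<Rightarrow> 'a graph" where
  "graph_union B R = \<lparr>verts = verts B, edges = edges B \<union> edges R\<rparr>"

definition graph_diff :: "'a graph \<Rightarrow> 'a graph \<Rightarrow> 'a graph" where
  "graph_diff R B = \<lparr>verts = verts R, edges = edges R - edges B\<rparr>"

definition induced_subgraph :: "'a graph \<Rightarrow> 'a set \<Rightarrow> 'a graph" where
  "induced_subgraph G S = \<lparr>verts = S, edges = {e \<in> edges G. e \<subseteq> S}\<rparr>"

definition isomorphic :: "'a graph \<Rightarrow> 'b graph \<Rightarrow> bool" where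
  "isomorphic G H \<longleftrightarrow> (\<exists>f. bij_betw f (verts G) (verts H) \<and> (\<lambda>e. f ` e) ` edges G = edges H)"

definition free_of :: "'b graph \<Rightarrow> 'a graph \<Rightarrow> bool" where
  "free_of H G \<longleftrightarrow> (\<forall>S \<subseteq> verts G. \<not> isomorphic (induced_subgraph G S) H)"

definition clique :: "'a graph \<Rightarrow> 'a set \<Rightarrow> bool" where
  "clique G K \<longleftrightarrow> K \<subseteq> verts G \<and> (\<forall>x \<in> K. \<forall>y \<in> K. x \<noteq> y \<longrightarrow> adjacent G x y)"

definition obedient :: "'a graph \<Rightarrow> 'a graph \<Rightarrow> 'a set \<Rightarrow> bool" where
  "obedient B R U \<longleftrightarrow> (\<exists>X Y. clique R X \<and> clique B Y \<and> U = X \<union> Y)"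

definition contains_double_C5 :: "'a graph \<Rightarrow> 'a graph \<Rightarrow> bool" where
  "contains_double_C5 B R \<longleftrightarrow>
     (\<exists>S \<subseteq> verts B. card S = 5 \<and>
        isomorphic (induced_subgraph B S) (cycle_graph 5) \<and>
        isomorphic (induced_subgraph R S) (cycle_graph 5))"

end

theory Submission
  imports Defs
begin

text \<open>
  Splitting \<open>V\<close> into a clique of \<open>R\<close> and a clique of \<open>B\<close> is a 2-satisfiability problem: two
  vertices that are adjacent only in \<open>R\<close> cannot both lie on the blue side, and two vertices that are
  adjacent only in \<open>B\<close> cannot both lie on the red side.  The vertices \<open>v1, v2, v3, v4\<close> determine
  their own sides.  If \<open>v2 v3\<close> were an edge of \<open>B\<close>, then \<open>v1 - v3 - v2 - v4 - v1\<close> would be an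
  induced \<open>C\<^sub>4\<close> in \<open>B\<close>; so \<open>v1 - v2 - v3 - v4\<close> is a path of pairs that are only red, and the
  other three pairs form the path \<open>v3 - v1 - v4 - v2\<close> of pairs that are only blue.  The only way to
  split these four vertices puts \<open>v2, v3\<close> on the red side and \<open>v1, v4\<close> on the blue side.

  Unit propagation starts from this choice: in every round, a vertex that misses an \<open>R\<close>-edge to the
  current red side is forced to the blue side, and a vertex that misses a \<open>B\<close>-edge to the current
  blue side is forced to the red side.  The heart of the proof is that propagation never runs into a
  conflict, that is, no vertex is forced to both sides and the sides remain cliques.  In the first
  round a conflict yields an induced \<open>C\<^sub>4\<close> or a double \<open>C\<^sub>5\<close> (lemma \<open>compatible_first_round\<close>).  In a
  later round every vertex has a reason for having been forced in that round and not earlier, and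
  two reasons together with a conflict make an induced \<open>C\<^sub>4\<close> (lemma \<open>compatible_next_round\<close>).

  After all rounds, every vertex outside the two sides is \<open>R\<close>-adjacent to the whole red side and
  \<open>B\<close>-adjacent to the whole blue side.  These remaining vertices form a proper subset of \<open>V\<close>, hence
  split into two cliques, which can be added to the two sides.
\<close>

section \<open>Recognising induced cycles\<close>

lemma adjacent_commute: "adjacent G x y \<longleftrightarrow> adjacent G y x"
  by (simp add: adjacent_def insert_commute)

lemma isomorphic_cycle_graphI:
  assumes G: "simple_graph G" and xs: "distinct xs" "length xs = k" "k > 0"
    and adj: "\<And>i j. i < k \<Longrightarrow> j < k \<Longrightarrow>
      adjacent G (xs ! i) (xs ! j) \<longleftrightarrow> j = Suc i mod k \<or> i = Suc j mod k"
  shows "isomorphic (induced_subgraph G (set xs)) (cycle_graph k)"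
proof -
  let ?f = "the_inv_into {..<k} ((!) xs)"
  have bij: "bij_betw ((!) xs) {..<k} (set xs)"
    using xs by (simp add: bij_betw_nth)
  have k: "Suc i mod k < k" for i
    using xs by simp
  have edges: "{e \<in> edges G. e \<subseteq> set xs} = (`) ((!) xs) ` {{i, Suc i mod k} | i. i < k}"
  proof (intro equalityI subsetI)
    fix e assume e: "e \<in> {e \<in> edges G. e \<subseteq> set xs}"
    then obtain x y where xy: "e = {x, y}"
      using G by (auto simp: simple_graph_def)
    with e obtain i j where ij: "i < k" "j < k" "x = xs ! i" "y = xs ! j"
      using xs(2) by (auto simp: in_set_conv_nth)
    with e xy have "j = Suc i mod k \<or> i = Suc j mod k"
      using adj by (simp add: adjacent_def)
    with ij xy have "\<exists>l<k. e = (!) xs ` {l, Suc l mod k}"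
      by (auto simp: insert_commute)
    then show "e \<in> (`) ((!) xs) ` {{i, Suc i mod k} | i. i < k}"
      by blast
  next
    fix e assume "e \<in> (`) ((!) xs) ` {{i, Suc i mod k} | i. i < k}"
    then obtain i where "i < k" "e = {xs ! i, xs ! (Suc i mod k)}"
      by auto
    with adj[of i "Suc i mod k"] k[of i] show "e \<in> {e \<in> edges G. e \<subseteq> set xs}"
      using xs(2) by (auto simp: adjacent_def)
  qed
  have "?f ` ((!) xs) ` e = e" if "e \<in> {{i, Suc i mod k} | i. i < k}" for e
  proof -
    have "e \<subseteq> {..<k}" using that k by auto
    then show ?thesis
      using bij by (force simp: image_image bij_betw_def the_inv_into_f_f)
  qed
  then have "(`) ?f ` {e \<in> edges G. e \<subseteq> set xs} = {{i, Suc i mod k} | i. i < k}"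
    unfolding edges image_image by force
  moreover have "bij_betw ?f (set xs) {..<k}"
    by (rule bij_betw_the_inv_into[OF bij])
  ultimately show ?thesis
    unfolding isomorphic_def induced_subgraph_def cycle_graph_def by auto
qed

lemma induced_C4_has_chord:
  assumes G: "simple_graph G" "free_of (cycle_graph 4) G"
    and cyc: "adjacent G w x" "adjacent G x y" "adjacent G y z" "adjacent G z w"
    and neq: "w \<noteq> y" "x \<noteq> z"
  shows "adjacent G w y \<or> adjacent G x z"
proof (rule ccontr)
  assume chordless: "\<not> ?thesis"
  let ?xs = "[w, x, y, z]"
  have loop: "\<not> adjacent G u u" for u
    using G(1) by (auto simp: simple_graph_def adjacent_def)
  have both: "adjacent G x w" "adjacent G y x" "adjacent G z y" "adjacent G w z"
    "adjacent G w x" "adjacent G x y" "adjacent G y z" "adjacent G z w"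
    using cyc by (simp_all add: adjacent_commute)
  have not_both: "\<not> adjacent G w y" "\<not> adjacent G y w" "\<not> adjacent G x z" "\<not> adjacent G z x"
    using chordless by (simp_all add: adjacent_commute)
  have vs: "set ?xs \<subseteq> verts G"
    using G(1) cyc by (auto simp: simple_graph_def adjacent_def doubleton_eq_iff)
  have "distinct ?xs"
    using cyc neq loop by auto
  moreover have "adjacent G (?xs ! i) (?xs ! j) \<longleftrightarrow> j = Suc i mod 4 \<or> i = Suc j mod 4"
    if "i < 4" "j < 4" for i j
  proof -
    have "i \<in> {0, 1, 2, 3}" "j \<in> {0, 1, 2, 3}"
      using that by auto
    then show ?thesis
      using not_both both loop by (elim insertE emptyE) simp_all
  qed
  ultimately have "isomorphic (induced_subgraph G (set ?xs)) (cycle_graph 4)"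
    by (intro isomorphic_cycle_graphI[OF G(1)]) auto
  then show False
    using G(2) vs by (auto simp: free_of_def)
qed

lemma isomorphic_C5I:
  assumes G: "simple_graph G" and dist: "distinct [a, b, c, d, e]"
    and cyc: "adjacent G a b" "adjacent G b c" "adjacent G c d" "adjacent G d e" "adjacent G e a"
    and chordless: "\<not> adjacent G a c" "\<not> adjacent G b d" "\<not> adjacent G c e"
      "\<not> adjacent G d a" "\<not> adjacent G e b"
  shows "isomorphic (induced_subgraph G {a, b, c, d, e}) (cycle_graph 5)"
proof -
  let ?xs = "[a, b, c, d, e]"
  have loop: "\<not> adjacent G u u" for u
    using G by (auto simp: simple_graph_def adjacent_def)
  have both: "adjacent G b a" "adjacent G c b" "adjacent G d c" "adjacent G e d" "adjacent G a e"
    "adjacent G a b" "adjacent G b c" "adjacent G c d" "adjacent G d e" "adjacent G e a"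
    using cyc by (simp_all add: adjacent_commute)
  have not_both: "\<not> adjacent G c a" "\<not> adjacent G d b" "\<not> adjacent G e c" "\<not> adjacent G a d"
    "\<not> adjacent G b e" "\<not> adjacent G a c" "\<not> adjacent G b d" "\<not> adjacent G c e"
    "\<not> adjacent G d a" "\<not> adjacent G e b"
    using chordless by (simp_all add: adjacent_commute)
  have "adjacent G (?xs ! i) (?xs ! j) \<longleftrightarrow> j = Suc i mod 5 \<or> i = Suc j mod 5"
    if "i < 5" "j < 5" for i j
  proof -
    have "i \<in> {0, 1, 2, 3, 4}" "j \<in> {0, 1, 2, 3, 4}"
      using that by auto
    then show ?thesis
      using not_both both loop by (elim insertE emptyE) simp_all
  qed
  then have "isomorphic (induced_subgraph G (set ?xs)) (cycle_graph 5)"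
    by (intro isomorphic_cycle_graphI[OF G dist]) auto
  then show ?thesis by simp
qed

section \<open>Unit propagation in a pair of graphs without induced 4-cycles\<close>

text \<open>
  The setting is symmetric in the two colours, so every statement about one side yields the
  statement about the other side through the interpretation with the colours exchanged.
\<close>

locale two_coloured =
  fixes V :: "'a set" and red blue :: "'a \<Rightarrow> 'a \<Rightarrow> bool"
  assumes red_sym: "red x y \<Longrightarrow> red y x"
    and blue_sym: "blue x y \<Longrightarrow> blue y x"
    and complete: "x \<in> V \<Longrightarrow> y \<in> V \<Longrightarrow> x \<noteq> y \<Longrightarrow> red x y \<or> blue x y"
    and red_C4: "red w x \<Longrightarrow> red x y \<Longrightarrow> red y z \<Longrightarrow> red z w \<Longrightarrow> w \<noteq> y \<Longrightarrow> x \<noteq> z \<Longrightarrow>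
      red w y \<or> red x z"
    and blue_C4: "blue w x \<Longrightarrow> blue x y \<Longrightarrow> blue y z \<Longrightarrow> blue z w \<Longrightarrow> w \<noteq> y \<Longrightarrow> x \<noteq> z \<Longrightarrow>
      blue w y \<or> blue x z"
begin

lemma colours_exchanged: "two_coloured V blue red"
  using red_sym blue_sym complete red_C4 blue_C4 by unfold_locales blast+

end

text \<open>
  The side \<open>P\<close> after one round of propagation, when \<open>Q\<close> is the other side and \<open>adj\<close> is the colour
  of \<open>Q\<close>.
\<close>

definition extend_side :: "'a set \<Rightarrow> ('a \<Rightarrow> 'a \<Rightarrow> bool) \<Rightarrow> 'a set \<Rightarrow> 'a set \<Rightarrow> 'a set" where
  "extend_side V adj P Q = P \<union> {v \<in> V - P - Q. \<exists>q\<in>Q. \<not> adj v q}"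

context two_coloured
begin

definition compatible :: "'a set \<Rightarrow> 'a set \<Rightarrow> bool" where
  "compatible P Q \<longleftrightarrow> P \<subseteq> V \<and> Q \<subseteq> V \<and> P \<inter> Q = {} \<and> pairwise blue P \<and> pairwise red Q"

lemma compatible_exchanged:
  "two_coloured.compatible V blue red Q P \<longleftrightarrow> compatible P Q"
  unfolding two_coloured.compatible_def[OF colours_exchanged] compatible_def by blast

text \<open>
  A vertex \<open>d\<close> newly forced to both sides would miss a red edge to some \<open>c\<close> and a blue edge to some
  \<open>a\<close>.  Both \<open>c\<close> and \<open>a\<close> were added in the last round, as \<open>d\<close> was not forced then; let \<open>p\<close> be the
  vertex that forced \<open>c\<close>, and \<open>q\<close> the one that forced \<open>a\<close>.  The pair \<open>a c\<close> can have neither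
  colour: if blue, then \<open>a - c - d - p - a\<close> is an induced blue 4-cycle, and if red, then
  \<open>a - c - q - d - a\<close> is an induced red one.
\<close>

lemma no_vertex_forced_twice:
  assumes P': "P' = extend_side V red P Q" and Q': "Q' = extend_side V blue Q P"
    and comp: "compatible P' Q'"
    and d: "d \<in> V" "d \<notin> P'" "d \<notin> Q'"
    and c: "c \<in> Q'" "\<not> red d c" and a: "a \<in> P'" "\<not> blue d a"
  shows False
proof -
  have complete_to_old: "red d q" if "q \<in> Q" for q
    using that d by (auto simp: P' Q' extend_side_def)
  have complete_to_old': "blue d p" if "p \<in> P" for p
    using that d by (auto simp: P' Q' extend_side_def)
  obtain p where p: "p \<in> P" "\<not> blue c p"
    using c complete_to_old by (auto simp: Q' extend_side_def)
  obtain q where q: "q \<in> Q" "\<not> red a q"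
    using a complete_to_old' by (auto simp: P' extend_side_def)
  have mem: "p \<in> P'" "q \<in> Q'" "a \<in> V" "c \<in> V" and disj: "P' \<inter> Q' = {}"
    and cliques: "pairwise blue P'" "pairwise red Q'"
    using p q a c comp by (auto simp: P' Q' extend_side_def compatible_def)
  have neq: "a \<noteq> c" "a \<noteq> q" "c \<noteq> p" "d \<noteq> a" "d \<noteq> c" "d \<noteq> p" "d \<noteq> q" "a \<noteq> p" "c \<noteq> q"
    using mem disj a c d p q complete_to_old complete_to_old' by auto
  have dc: "blue d c" and da: "red d a"
    using complete d mem neq c a by blast+
  have ap: "blue a p" and cq: "red c q"
    using cliques mem a c neq by (auto simp: pairwise_def)
  have "\<not> blue a c"
    using blue_C4[of a c d p] p dc ap neq complete_to_old' blue_sym a by blast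
  moreover have "\<not> red a c"
    using red_C4[of a c q d] q da cq neq complete_to_old red_sym c by blast
  ultimately show False
    using complete mem neq by blast
qed

text \<open>
  Two newly forced vertices \<open>d\<close>, \<open>d'\<close> miss red edges to some \<open>c\<close>, \<open>c'\<close>, respectively, and the
  vertices that forced \<open>c\<close> and \<open>c'\<close> are joined to both \<open>d\<close> and \<open>d'\<close> in blue.  Suppose that \<open>d d'\<close>
  is not blue.  If \<open>d' c\<close> were blue, then \<open>d\<close>, \<open>c\<close>, \<open>d'\<close> and the vertex that forced \<open>c\<close> would form an
  induced blue 4-cycle; likewise \<open>d c'\<close> is not blue.  Hence \<open>d - d' - c - c' - d\<close> is an induced red
  4-cycle.
\<close>

lemma extended_side_is_clique:
  assumes P': "P' = extend_side V red P Q" and Q': "Q' = extend_side V blue Q P"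
    and comp: "compatible P' Q'"
  shows "pairwise blue (extend_side V red P' Q')"
proof -
  let ?N = "{v \<in> V - P' - Q'. \<exists>q\<in>Q'. \<not> red v q}"
  have side: "P \<subseteq> P'" "Q \<subseteq> Q'" "P' \<subseteq> V" "Q' \<subseteq> V" "pairwise blue P'" "pairwise red Q'"
    using comp by (auto simp: P' Q' extend_side_def compatible_def)
  have old_new: "blue d a" if "d \<in> ?N" "a \<in> P'" for d a
  proof -
    obtain q where "q \<in> Q'" "\<not> red d q"
      using \<open>d \<in> ?N\<close> by blast
    then show ?thesis
      using no_vertex_forced_twice[OF assms, of d q a] that by auto
  qed
  have new_new: "blue d d'" if d: "d \<in> ?N" and d': "d' \<in> ?N" and neq: "d \<noteq> d'" for d d'
  proof (rule ccontr)
    assume not_blue: "\<not> blue d d'"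
    then have dd': "red d d'"
      using complete d d' neq by blast
    have no_common: False if c: "c \<in> Q'" "\<not> red u c" and "u \<in> ?N" "w \<in> ?N" "u \<noteq> w"
      and uw: "\<not> blue u w" and "blue w c" for u w c
    proof -
      have "red u q" if "q \<in> Q" for q
        using that \<open>u \<in> ?N\<close> by (auto simp: P' Q' extend_side_def)
      then obtain p where p: "p \<in> P" "\<not> blue c p"
        using c by (auto simp: Q' extend_side_def)
      have "p \<in> P'"
        using p side by blast
      then have "blue u p" "blue w p"
        using old_new \<open>u \<in> ?N\<close> \<open>w \<in> ?N\<close> by simp_all
      moreover have "c \<in> V" "u \<in> V" "u \<noteq> c"
        using c \<open>u \<in> ?N\<close> side by auto
      then have "blue u c"
        using complete c(2) by blast
      moreover have "c \<noteq> p"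
        using c \<open>p \<in> P'\<close> comp unfolding compatible_def by blast
      ultimately show False
        using blue_C4[OF _ blue_sym[of w c] _ blue_sym[of u p]] p uw \<open>u \<noteq> w\<close> \<open>blue w c\<close> by blast
    qed
    obtain c where c: "c \<in> Q'" "\<not> red d c" using d by blast
    obtain c' where c': "c' \<in> Q'" "\<not> red d' c'" using d' by blast
    have "\<not> blue d' d"
      using not_blue blue_sym by blast
    then have "\<not> blue d' c" "\<not> blue d c'"
      using no_common[OF c d d' neq not_blue] no_common[OF c' d' d neq[symmetric]] by blast+
    moreover have "c \<in> V" "c' \<in> V" "d \<in> V" "d' \<in> V" "d' \<noteq> c" "d \<noteq> c'"
      using c c' d d' side by auto
    ultimately have cross: "red d' c" "red d c'"
      using complete by blast+
    then have "c \<noteq> c'"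
      using c by blast
    then have "red c c'"
      using c c' side by (auto simp: pairwise_def)
    then show False
      using red_C4[OF dd' cross(1) _ red_sym[OF cross(2)]] c c' d d' by blast
  qed
  show ?thesis
  proof (rule pairwiseI)
    fix x y assume xy: "x \<in> extend_side V red P' Q'" "y \<in> extend_side V red P' Q'" "x \<noteq> y"
    then consider "x \<in> P'" "y \<in> P'" | "x \<in> ?N" "y \<in> P'" | "x \<in> P'" "y \<in> ?N" | "x \<in> ?N" "y \<in> ?N"
      unfolding extend_side_def by blast
    then show "blue x y"
      using side(5) old_new[of x y] old_new[of y x, THEN blue_sym] new_new[of x y] \<open>x \<noteq> y\<close>
      by cases (auto simp: pairwise_def)
  qed
qed

lemma compatible_next_round:
  assumes P': "P' = extend_side V red P Q" and Q': "Q' = extend_side V blue Q P"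
    and comp: "compatible P' Q'"
  shows "compatible (extend_side V red P' Q') (extend_side V blue Q' P')"
proof -
  interpret ex: two_coloured V blue red by (rule colours_exchanged)
  have "extend_side V red P' Q' \<inter> extend_side V blue Q' P' = {}"
    using no_vertex_forced_twice[OF assms] comp
    by (auto simp: extend_side_def compatible_def)
  moreover have "pairwise blue (extend_side V red P' Q')"
    by (rule extended_side_is_clique[OF assms])
  moreover have "pairwise red (extend_side V blue Q' P')"
    using ex.extended_side_is_clique[OF Q' P'] comp by (simp add: compatible_exchanged)
  moreover have "extend_side V red P' Q' \<subseteq> V" "extend_side V blue Q' P' \<subseteq> V"
    using comp by (auto simp: extend_side_def compatible_def)
  ultimately show ?thesis
    unfolding compatible_def by blast
qed

fun sides :: "'a set \<Rightarrow> 'a set \<Rightarrow> nat \<Rightarrow> 'a set \<times> 'a set" where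
  "sides P Q 0 = (P, Q)"
| "sides P Q (Suc n) =
    (let (P', Q') = sides P Q n in (extend_side V red P' Q', extend_side V blue Q' P'))"

lemma sides_Suc:
  "fst (sides P Q (Suc n)) = extend_side V red (fst (sides P Q n)) (snd (sides P Q n))"
  "snd (sides P Q (Suc n)) = extend_side V blue (snd (sides P Q n)) (fst (sides P Q n))"
  by (simp_all add: case_prod_beta Let_def)

text \<open>
  The closed sides are the unions over all rounds.  As \<open>V\<close> may be infinite, no single round need be
  final, but any two vertices of the unions already occur together in one round, which carries
  compatibility over to the unions.
\<close>

lemma closed_sides_exist:
  assumes first: "compatible (extend_side V red P Q) (extend_side V blue Q P)"
  obtains P' Q' where "P \<subseteq> P'" "Q \<subseteq> Q'" "compatible P' Q'"
    and "\<And>v q. v \<in> V - P' - Q' \<Longrightarrow> q \<in> Q' \<Longrightarrow> red v q"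
    and "\<And>v p. v \<in> V - P' - Q' \<Longrightarrow> p \<in> P' \<Longrightarrow> blue v p"
proof -
  define S where "S n = fst (sides P Q n)" for n
  define T where "T n = snd (sides P Q n)" for n
  have Suc: "S (Suc n) = extend_side V red (S n) (T n)"
    "T (Suc n) = extend_side V blue (T n) (S n)" for n
    unfolding S_def T_def by (rule sides_Suc)+
  have zero: "S 0 = P" "T 0 = Q"
    by (simp_all add: S_def T_def)
  have comp: "compatible (S (Suc n)) (T (Suc n))" for n
  proof (induction n)
    case 0
    show ?case using first by (simp add: Suc zero)
  next
    case IH: (Suc n)
    show ?case
      using compatible_next_round[OF Suc IH] by (simp only: Suc[of "Suc n"])
  qed
  have mono: "S m \<subseteq> S n \<and> T m \<subseteq> T n" if "m \<le> n" for m n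
    using lift_Suc_mono_le[of S, OF _ that] lift_Suc_mono_le[of T, OF _ that]
    by (simp add: Suc extend_side_def)
  have common_round: "\<exists>n. compatible (S n) (T n) \<and> S m \<subseteq> S n \<and> T m \<subseteq> T n \<and> S l \<subseteq> S n \<and> T l \<subseteq> T n"
    for m l
    using comp[of "max m l"] mono[of m "Suc (max m l)"] mono[of l "Suc (max m l)"]
    by (intro exI[of _ "Suc (max m l)"]) simp
  show ?thesis
  proof (rule that)
    show "P \<subseteq> (\<Union>n. S n)" "Q \<subseteq> (\<Union>n. T n)"
      using zero by blast+
    show "compatible (\<Union>n. S n) (\<Union>n. T n)"
    proof -
      have "S m \<subseteq> V" "T m \<subseteq> V" for m
        using common_round[of m m] unfolding compatible_def by blast+
      moreover have "S m \<inter> T l = {}" for m l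
        using common_round[of m l] unfolding compatible_def by blast
      moreover have "blue x y" if "x \<in> S m" "y \<in> S l" "x \<noteq> y" for x y m l
        using common_round[of m l] that unfolding compatible_def pairwise_def
        by (meson subsetD)
      moreover have "red x y" if "x \<in> T m" "y \<in> T l" "x \<noteq> y" for x y m l
        using common_round[of m l] that unfolding compatible_def pairwise_def
        by (meson subsetD)
      ultimately show ?thesis
        unfolding compatible_def pairwise_def by (auto; blast)
    qed
  next
    fix v q assume v: "v \<in> V - (\<Union>n. S n) - (\<Union>n. T n)" and "q \<in> (\<Union>n. T n)"
    then obtain n where "q \<in> T n" by blast
    moreover have "v \<notin> S (Suc n)" using v by blast
    ultimately show "red v q"
      using v by (auto simp: Suc extend_side_def)
  next
    fix v p assume v: "v \<in> V - (\<Union>n. S n) - (\<Union>n. T n)" and "p \<in> (\<Union>n. S n)"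
    then obtain n where "p \<in> S n" by blast
    moreover have "v \<notin> T (Suc n)" using v by blast
    ultimately show "blue v p"
      using v by (auto simp: Suc extend_side_def)
  qed
qed

end

section \<open>The first round\<close>

text \<open>
  The pairs on the path \<open>p1 - q1 - q2 - p2\<close> are only red, and the pairs on its complement
  \<open>q1 - p2 - p1 - q2\<close> are only blue.  The assumption on a fifth vertex \<open>v\<close> says that \<open>v\<close> does not
  complete both paths to 5-cycles.  Exchanging the colours turns the path into \<open>q2 - p1 - p2 - q1\<close>.
\<close>

locale alternating_P4 = two_coloured +
  fixes p1 q1 q2 p2
  assumes in_V: "p1 \<in> V" "q1 \<in> V" "q2 \<in> V" "p2 \<in> V"
    and distinct_path: "distinct [p1, q1, q2, p2]"
    and red_path: "red p1 q1" "red q1 q2" "red q2 p2"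
    and not_blue: "\<not> blue p1 q1" "\<not> blue q1 q2" "\<not> blue q2 p2"
    and blue_path: "blue q1 p2" "blue p2 p1" "blue p1 q2"
    and not_red: "\<not> red q1 p2" "\<not> red p2 p1" "\<not> red p1 q2"
    and no_double_C5: "v \<in> V \<Longrightarrow> red v p1 \<Longrightarrow> red v p2 \<Longrightarrow> \<not> red v q1 \<Longrightarrow> \<not> red v q2 \<Longrightarrow>
      blue v q1 \<Longrightarrow> blue v q2 \<Longrightarrow> \<not> blue v p1 \<Longrightarrow> \<not> blue v p2 \<Longrightarrow> False"
begin

lemma P4_exchanged: "alternating_P4 V blue red q2 p1 p2 q1"
proof -
  interpret ex: two_coloured V blue red by (rule colours_exchanged)
  show ?thesis
    using in_V distinct_path red_path not_blue blue_path not_red no_double_C5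
    by unfold_locales (auto dest: red_sym blue_sym)
qed

text \<open>
  A vertex \<open>v\<close> that is not red to one of \<open>q1, q2\<close> and not blue to one of \<open>p1, p2\<close> would be forced
  to both sides.  Chasing the 4-cycles through \<open>v\<close> and three vertices of the path shows that \<open>v\<close>
  is only blue to both of \<open>q1, q2\<close> and only red to both of \<open>p1, p2\<close>, so that \<open>v\<close> and the path
  form a double \<open>C\<^sub>5\<close>.
\<close>

lemma vertex_fits_a_side:
  assumes v: "v \<in> V" "v \<notin> {p1, q1, q2, p2}"
  shows "(red v q1 \<and> red v q2) \<or> (blue v p1 \<and> blue v p2)"
proof (rule ccontr)
  assume neg: "\<not> ?thesis"
  have any: "red v x \<or> blue v x" if "x \<in> {p1, q1, q2, p2}" for x
    using complete[of v x] v in_V that by blast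
  have "blue v p1 \<Longrightarrow> blue v q1 \<Longrightarrow> blue v p2"
    using blue_C4[of v p1 p2 q1] blue_path not_blue v distinct_path blue_sym by auto
  moreover have "blue v p2 \<Longrightarrow> blue v q2 \<Longrightarrow> blue v p1"
    using blue_C4[of v p2 p1 q2] blue_path not_blue v distinct_path blue_sym by auto
  moreover have "red v p1 \<Longrightarrow> red v q2 \<Longrightarrow> red v q1"
    using red_C4[of v p1 q1 q2] red_path not_red v distinct_path red_sym by auto
  moreover have "red v p2 \<Longrightarrow> red v q1 \<Longrightarrow> red v q2"
    using red_C4[of v p2 q2 q1] red_path not_red v distinct_path red_sym by auto
  ultimately show False
    using neg any no_double_C5[of v] v by blast
qed

text \<open>
  Let \<open>u, w\<close> be two forced vertices that are only red to each other.  They are not both blue to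
  \<open>q2\<close>, because of \<open>u - q2 - w - p2 - u\<close>, nor both blue to \<open>q1\<close>, because of \<open>u - q1 - w - p1 - u\<close>.
  As each of them misses a red edge to \<open>q1\<close> or \<open>q2\<close>, the edge \<open>q1 q2\<close> completes an induced red
  4-cycle with \<open>u w\<close>.
\<close>

lemma first_blue_side_is_clique:
  "pairwise blue (extend_side V red {p1, p2} {q1, q2})"
proof -
  let ?N = "{v \<in> V - {p1, p2} - {q1, q2}. \<exists>q\<in>{q1, q2}. \<not> red v q}"
  have to_p: "blue u p1" "blue u p2" if "u \<in> ?N" for u
    using vertex_fits_a_side[of u] that by auto
  have new: "blue u w" if u: "u \<in> ?N" and w: "w \<in> ?N" and "u \<noteq> w" for u w
  proof (rule ccontr)
    assume not_blue_uw: "\<not> blue u w"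
    then have red_uw: "red u w"
      using complete u w \<open>u \<noteq> w\<close> by blast
    have any: "red x y \<or> blue x y" if "x \<in> {u, w}" "y \<in> {q1, q2}" for x y
      using complete[of x y] u w in_V that by auto
    have "\<not> (blue u q2 \<and> blue w q2)"
      using blue_C4[of u q2 w p2] to_p[OF u] to_p[OF w] not_blue not_blue_uw u w \<open>u \<noteq> w\<close>
        distinct_path blue_sym by auto
    moreover have "\<not> (blue u q1 \<and> blue w q1)"
      using blue_C4[of u q1 w p1] to_p[OF u] to_p[OF w] not_blue not_blue_uw u w \<open>u \<noteq> w\<close>
        distinct_path blue_sym by auto
    \<comment> \<open>So one of \<open>u, w\<close> is only red to \<open>q1\<close>, and the other one only red to \<open>q2\<close>.\<close>
    moreover have "red u q1 \<Longrightarrow> red w q2 \<Longrightarrow> red u q2 \<or> red w q1"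
      using red_C4[of u q1 q2 w] red_path red_uw u w red_sym by auto
    moreover have "red w q1 \<Longrightarrow> red u q2 \<Longrightarrow> red w q2 \<or> red u q1"
      using red_C4[of w q1 q2 u] red_path red_uw u w red_sym by auto
    ultimately show False
      using any u w by blast
  qed
  show ?thesis
    unfolding extend_side_def
    using new to_p blue_path blue_sym by (auto simp: pairwise_def)
qed

lemma compatible_first_round:
  "compatible (extend_side V red {p1, p2} {q1, q2}) (extend_side V blue {q1, q2} {p1, p2})"
proof -
  interpret ex: alternating_P4 V blue red q2 p1 p2 q1 by (rule P4_exchanged)
  have "pairwise red (extend_side V blue {q1, q2} {p1, p2})"
    using ex.first_blue_side_is_clique by (simp add: insert_commute)
  moreover have "extend_side V red {p1, p2} {q1, q2} \<inter> extend_side V blue {q1, q2} {p1, p2} = {}"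
    using vertex_fits_a_side distinct_path by (auto simp: extend_side_def)
  ultimately show ?thesis
    using first_blue_side_is_clique in_V by (auto simp: compatible_def extend_side_def)
qed

end

section \<open>Obedience of the whole vertex set\<close>

theorem theorem1p8:
  fixes B R :: "'a graph" and V :: "'a set" and v1 v2 v3 v4 v5 :: 'a
  assumes "simple_graph B" and "simple_graph R"
    and "verts B = V" and "verts R = V"
    and "free_of (cycle_graph 4) B" and "free_of (cycle_graph 4) R"
    and "\<not> contains_double_C5 B R"
    and "graph_union B R = complete_graph V"
    and "\<forall>U. U \<subset> V \<longrightarrow> obedient B R U"
    and "{v1, v2, v3, v4, v5} \<subseteq> V" and "distinct [v1, v2, v3, v4, v5]"
    and "edges (induced_subgraph R {v1, v2, v3, v4, v5}) =
           {{v1, v2}, {v2, v3}, {v3, v4}, {v4, v5}, {v5, v1}}"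
    and "{v1, v2} \<in> edges (graph_diff R B)" and "{v3, v4} \<in> edges (graph_diff R B)"
  shows "obedient B R V"
proof -
  let ?r = "adjacent R" and ?b = "adjacent B"
  have complete: "?r x y \<or> ?b x y" if "x \<in> V" "y \<in> V" "x \<noteq> y" for x y
  proof -
    have "{x, y} \<in> edges (complete_graph V)"
      using that by (auto simp: complete_graph_def)
    then show ?thesis
      unfolding assms(8)[symmetric] by (auto simp: graph_union_def adjacent_def)
  qed
  interpret two_coloured V ?r ?b
  proof
    show "?r y x" if "?r x y" for x y
      using that by (simp add: adjacent_commute)
    show "?b y x" if "?b x y" for x y
      using that by (simp add: adjacent_commute)
    show "?r x y \<or> ?b x y" if "x \<in> V" "y \<in> V" "x \<noteq> y" for x y
      by (rule complete[OF that])
    show "?r w y \<or> ?r x z"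
      if "?r w x" "?r x y" "?r y z" "?r z w" "w \<noteq> y" "x \<noteq> z" for w x y z
      by (rule induced_C4_has_chord[OF assms(2,6) that])
    show "?b w y \<or> ?b x z"
      if "?b w x" "?b x y" "?b y z" "?b z w" "w \<noteq> y" "x \<noteq> z" for w x y z
      by (rule induced_C4_has_chord[OF assms(1,5) that])
  qed
  have dist: "distinct [v1, v2, v3, v4]" and in_V: "v1 \<in> V" "v2 \<in> V" "v3 \<in> V" "v4 \<in> V"
    using assms(10,11) by auto
  have R_on_cycle: "?r x y \<longleftrightarrow> {x, y} \<in> {{v1, v2}, {v2, v3}, {v3, v4}, {v4, v5}, {v5, v1}}"
    if "x \<in> {v1, v2, v3, v4, v5}" "y \<in> {v1, v2, v3, v4, v5}" for x y
    using that unfolding assms(12)[symmetric] by (auto simp: induced_subgraph_def adjacent_def)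
  have red_path: "?r v1 v2" "?r v2 v3" "?r v3 v4"
    and not_red: "\<not> ?r v2 v4" "\<not> ?r v4 v1" "\<not> ?r v1 v3"
    using assms(11) by (auto simp: R_on_cycle doubleton_eq_iff)
  then have blue_path: "?b v2 v4" "?b v4 v1" "?b v1 v3"
    using complete in_V dist by auto
  have not_blue: "\<not> ?b v1 v2" "\<not> ?b v3 v4"
    using assms(13,14) by (auto simp: graph_diff_def adjacent_def)
  have not_blue_23: "\<not> ?b v2 v3"
    using blue_C4[OF blue_path(3) _ blue_path(1,2)] blue_sym[of v2 v3] not_blue dist by auto
  interpret alternating_P4 V ?r ?b v1 v2 v3 v4
  proof
    fix v
    assume v: "v \<in> V" and red: "?r v v1" "?r v v4" "\<not> ?r v v2" "\<not> ?r v v3"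
      and blue: "?b v v2" "?b v v3" "\<not> ?b v v1" "\<not> ?b v v4"
    have neq: "v \<notin> {v1, v2, v3, v4}"
      using red blue red_path blue_path by (auto simp: adjacent_commute)
    have "isomorphic (induced_subgraph R {v, v1, v2, v3, v4}) (cycle_graph 5)"
      using dist neq red red_path not_red
      by (intro isomorphic_C5I[OF assms(2)]) (auto simp: adjacent_commute)
    moreover have "isomorphic (induced_subgraph B {v, v2, v4, v1, v3}) (cycle_graph 5)"
      using dist neq blue blue_path not_blue not_blue_23
      by (intro isomorphic_C5I[OF assms(1)]) (auto simp: adjacent_commute)
    moreover have "{v, v2, v4, v1, v3} = {v, v1, v2, v3, v4}"
      by blast
    moreover have "card {v, v1, v2, v3, v4} = 5"
      using dist neq by auto
    moreover have "{v, v1, v2, v3, v4} \<subseteq> verts B"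
      using assms(3) v in_V by simp
    ultimately show False
      using assms(7) unfolding contains_double_C5_def by metis
  qed (use in_V dist red_path not_red blue_path not_blue not_blue_23 in auto)
  obtain P Q where PQ: "{v1, v4} \<subseteq> P" "{v2, v3} \<subseteq> Q" "compatible P Q"
    and rest: "\<And>v q. v \<in> V - P - Q \<Longrightarrow> q \<in> Q \<Longrightarrow> ?r v q"
      "\<And>v p. v \<in> V - P - Q \<Longrightarrow> p \<in> P \<Longrightarrow> ?b v p"
    by (rule closed_sides_exist[OF compatible_first_round]) (rule that)
  have "V - P - Q \<subset> V"
    using PQ(1) in_V(1) by auto
  then have "obedient B R (V - P - Q)"
    using assms(9) by simp
  then obtain X Y where XY: "clique R X" "clique B Y" "V - P - Q = X \<union> Y"
    unfolding obedient_def by (elim exE conjE)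
  have "?r x q \<and> ?r q x" if "x \<in> X" "q \<in> Q" for x q
    using rest(1)[of x q] XY(3) that by (auto simp: adjacent_commute)
  then have "clique R (X \<union> Q)"
    using XY(1) PQ(3) assms(4) unfolding clique_def compatible_def pairwise_def by auto
  moreover have "?b y p \<and> ?b p y" if "y \<in> Y" "p \<in> P" for y p
    using rest(2)[of y p] XY(3) that by (auto simp: adjacent_commute)
  then have "clique B (Y \<union> P)"
    using XY(2) PQ(3) assms(3) unfolding clique_def compatible_def pairwise_def by auto
  moreover have "V = (X \<union> Q) \<union> (Y \<union> P)"
    using XY(3) PQ(3) unfolding compatible_def by blast
  ultimately show ?thesis
    unfolding obedient_def by (intro exI conjI)
qed

end
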